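(* Let $n\ge1$, $\epsilon\in\mathbb{R}$ with $\epsilon\neq1$, $c_1,\dots,c_n\in\mathbb{R}$, $W\in\mathbb{R}^{n\times n}$, and for $1\le i\le n$ let $\phi_i:\mathbb{R}\to\mathbb{R}$ be a smooth sigmoidal function with Lipschitz constant $\mathcal{L}\ge0$. Let $(\mathcal{F},\mathbb{R}^n)$ be the Cohen-Grossberg network $$\mathcal{F}_j(\mathbf{x})=(1-\epsilon)x_j+\sum_{i=1}^nW_{ij}\phi_i(x_i)+c_j,\qquad 1\le j\le n.$$ If $|1-\epsilon|+\mathcal{L}\,\rho(|W|)<1$, then $(\mathcal{F},\mathbb{R}^n)$ has a globally attracting fixed point.
   Context: $|W|$ is the matrix with entries $|W|_{ij}=|W_{ij}|$ and $\rho$ is the spectral radius. "Sigmoidal" is used in the standard sense of a bounded nondecreasing (S-shaped) function, such as $\tanh(\mathcal{L}x)$. $(\mathcal{F},\mathbb{R}^n)$ has a globally attracting fixed point $\tilde{\mathbf{x}}\in\mathbb{R}^n$ if $\tilde{\mathbf x}$ is a fixed point of $\mathcal{F}$ and $\lim_{k\to\infty}\max_i|\mathcal{F}^k(\mathbf{x})_i-\tilde x_i|=0$ for every $\mathbf{x}\in\mathbb{R}^n$. *)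

theory Defs
  imports
    "HOL-Analysis.Derivative"
    "HOL-Analysis.Lipschitz"
    "Jordan_Normal_Form.Spectral_Radius"
begin

text \<open>\<open>\<real>\<^sup>n\<close> is \<^term>\<open>carrier_vec n :: real vec set\<close> and \<open>\<real>\<^sup>n\<^sup>\<times>\<^sup>n\<close> is
  \<^term>\<open>carrier_mat n n :: real mat set\<close>; the indices \<open>1, \<dots>, n\<close> become \<open>0, \<dots>, n - 1\<close>.\<close>

unbundle no vec_syntax

definition smooth :: "(real \<Rightarrow> real) \<Rightarrow> bool" where
  "smooth f \<longleftrightarrow> (\<forall>k x. (deriv ^^ k) f differentiable (at x))"

definition sigmoidal :: "(real \<Rightarrow> real) \<Rightarrow> bool" where
  "sigmoidal f \<longleftrightarrow> bounded (range f) \<and> mono f"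

definition abs_mat :: "real mat \<Rightarrow> real mat" where
  "abs_mat W = map_mat abs W"

text \<open>Eigenvalues of a real matrix are taken over the complex numbers.\<close>

definition real_spectral_radius :: "real mat \<Rightarrow> real" where
  "real_spectral_radius A = spectral_radius (map_mat complex_of_real A)"

text \<open>The sum runs over the first index of \<open>W\<close>, so the linear coupling is through the
  transpose of \<open>W\<close>.\<close>

definition cohen_grossberg ::
  "nat \<Rightarrow> real \<Rightarrow> real mat \<Rightarrow> (nat \<Rightarrow> real \<Rightarrow> real) \<Rightarrow> real vec \<Rightarrow> real vec \<Rightarrow> real vec" where
  "cohen_grossberg n \<epsilon> W \<phi> c x =
     vec n (\<lambda>j. (1 - \<epsilon>) * x $ j + (\<Sum>i<n. W $$ (i, j) * \<phi> i (x $ i)) + c $ j)"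

text \<open>Only meaningful for \<open>n \<ge> 1\<close>, since the maximum is over \<open>i < n\<close>.\<close>

definition globally_attracting_fixed_point ::
  "nat \<Rightarrow> (real vec \<Rightarrow> real vec) \<Rightarrow> real vec \<Rightarrow> bool" where
  "globally_attracting_fixed_point n F z \<longleftrightarrow>
     z \<in> carrier_vec n \<and> F z = z \<and>
     (\<forall>x \<in> carrier_vec n. (\<lambda>k. MAX i\<in>{..<n}. \<bar>(F ^^ k) x $ i - z $ i\<bar>) \<longlonglongrightarrow> 0)"

end

theory Submission
  imports Defs
begin

text \<open>Since each \<open>\<phi>\<^sub>i\<close> is \<open>L\<close>-Lipschitz, one step of the network turns the row vector \<open>d\<close> of
  coordinate distances between two states into a vector that is at most \<open>d B\<close> in every
  coordinate, where \<open>B = \<bar>1 - \<epsilon>\<bar> I + L \<bar>W\<bar>\<close> is nonnegative; after \<open>k\<close> steps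
  the bound is \<open>d B\<^sup>k\<close>
  (lemma \<open>funpow_coordinate_bound\<close>). The eigenvalues of \<open>B\<close> are \<open>\<bar>1 - \<epsilon>\<bar> + L \<nu>\<close> with \<open>\<nu>\<close> an
  eigenvalue of \<open>\<bar>W\<bar>\<close>, so the hypothesis gives \<open>\<rho>(B) < 1\<close>
  (lemma \<open>spectral_radius_affine_le\<close>), and then the entries of \<open>B\<^sup>k\<close> decay geometrically
  (lemma \<open>pow_mat_geometric_bound\<close>).

  Geometric decay makes one orbit Cauchy in every coordinate, its limit is a fixed point by
  continuity, and every other orbit is drawn to it at the same rate
  (lemma \<open>matrix_contraction_fixed_point\<close>). This is the Banach fixed point argument with the
  contraction constant replaced by a matrix: a single step of the map may well expand distances
  in the maximum norm, and only high powers of \<open>B\<close> need contract them.\<close>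

section \<open>Spectral radius and decay of matrix powers\<close>

text \<open>For \<open>b \<noteq> 0\<close> an eigenvector of \<open>a I + b A\<close> is one of \<open>A\<close>. For \<open>b = 0\<close> the only eigenvalue
  is \<open>a\<close>, and \<open>\<nu>\<close> can be any eigenvalue of \<open>A\<close>; one exists because \<open>n > 0\<close>.\<close>

lemma spectrum_affine:
  fixes A :: "complex mat"
  assumes A: "A \<in> carrier_mat n n" and n: "n > 0"
    and \<mu>: "\<mu> \<in> spectrum (a \<cdot>\<^sub>m 1\<^sub>m n + b \<cdot>\<^sub>m A)"
  shows "\<exists>\<nu> \<in> spectrum A. \<mu> = a + b * \<nu>"
proof -
  let ?M = "a \<cdot>\<^sub>m 1\<^sub>m n + b \<cdot>\<^sub>m A"
  from \<mu> obtain v where "eigenvector ?M v \<mu>"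
    by (auto simp: spectrum_def eigenvalue_def)
  with A have v: "v \<in> carrier_vec n" "v \<noteq> 0\<^sub>v n" and Mv: "?M *\<^sub>v v = \<mu> \<cdot>\<^sub>v v"
    by (auto simp: eigenvector_def)
  have Mv_sum: "?M *\<^sub>v v = a \<cdot>\<^sub>v v + b \<cdot>\<^sub>v (A *\<^sub>v v)"
    using A v by (subst add_mult_distrib_mat_vec[of _ n n]) (auto intro!: eq_vecI)
  have coord: "a * v $ i + b * (A *\<^sub>v v) $ i = \<mu> * v $ i" if "i < n" for i
  proof -
    have "(a \<cdot>\<^sub>v v + b \<cdot>\<^sub>v (A *\<^sub>v v)) $ i = (\<mu> \<cdot>\<^sub>v v) $ i"
      using Mv Mv_sum by simp
    then show ?thesis
      using that A v by simp
  qed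
  show ?thesis
  proof (cases "b = 0")
    case True
    obtain i where "i < n" "v $ i \<noteq> 0"
      using v by (metis carrier_vecD eq_vecI index_zero_vec)
    with coord[of i] True have "\<mu> = a"
      by simp
    then show ?thesis
      using spectrum_non_empty[OF A n] True by auto
  next
    case False
    have "A *\<^sub>v v = ((\<mu> - a) / b) \<cdot>\<^sub>v v"
    proof (rule eq_vecI)
      fix i assume "i < dim_vec (((\<mu> - a) / b) \<cdot>\<^sub>v v)"
      then have "i < n" using v by simp
      then show "(A *\<^sub>v v) $ i = (((\<mu> - a) / b) \<cdot>\<^sub>v v) $ i"
        using coord[of i] False v A by (simp add: field_simps del: index_mult_mat_vec)
    qed (use A v in auto)
    then have "eigenvector A v ((\<mu> - a) / b)"
      using A v by (simp add: eigenvector_def)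
    then have "(\<mu> - a) / b \<in> spectrum A"
      by (auto simp: spectrum_def eigenvalue_def)
    then show ?thesis
      using False by (intro bexI) auto
  qed
qed

lemma spectral_radius_affine_le:
  fixes A :: "complex mat"
  assumes A: "A \<in> carrier_mat n n" and n: "n > 0"
  shows "spectral_radius (a \<cdot>\<^sub>m 1\<^sub>m n + b \<cdot>\<^sub>m A) \<le> norm a + norm b * spectral_radius A"
proof -
  let ?M = "a \<cdot>\<^sub>m 1\<^sub>m n + b \<cdot>\<^sub>m A"
  have M: "?M \<in> carrier_mat n n"
    using A by simp
  obtain \<mu> where \<mu>: "\<mu> \<in> spectrum ?M" "spectral_radius ?M = norm \<mu>"
    using spectral_radius_mem_max(1)[OF M n] by auto
  obtain \<nu> where \<nu>: "\<nu> \<in> spectrum A" "\<mu> = a + b * \<nu>"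
    using spectrum_affine[OF A n \<mu>(1)] by auto
  have "norm \<mu> \<le> norm a + norm b * norm \<nu>"
    using \<nu>(2) norm_triangle_ineq[of a "b * \<nu>"] by (simp add: norm_mult)
  also have "norm \<nu> \<le> spectral_radius A"
    using spectral_radius_mem_max(2)[OF A n] \<nu>(1) by auto
  finally show ?thesis
    using \<mu>(2) by (simp add: mult_left_mono)
qed

lemma pow_mat_smult:
  fixes A :: "'a :: comm_ring_1 mat"
  assumes A: "A \<in> carrier_mat n n"
  shows "(s \<cdot>\<^sub>m A) ^\<^sub>m k = s ^ k \<cdot>\<^sub>m (A ^\<^sub>m k)"
proof (induction k)
  case 0
  then show ?case by (auto intro!: eq_matI)
next
  case (Suc k)
  have Ak: "A ^\<^sub>m k \<in> carrier_mat n n"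
    using A by simp
  have "(s \<cdot>\<^sub>m A) ^\<^sub>m Suc k = (s ^ k \<cdot>\<^sub>m A ^\<^sub>m k) * (s \<cdot>\<^sub>m A)"
    using Suc by simp
  also have "\<dots> = s ^ Suc k \<cdot>\<^sub>m (A ^\<^sub>m k * A)"
    using A Ak by (intro eq_matI) (auto simp: mult_ac)
  finally show ?case by simp
qed

text \<open>The scaled matrix \<open>A / r\<close> has spectral radius below \<open>1\<close>, so by the Jordan normal form its
  powers are bounded; undoing the scaling turns the bound into the factor \<open>r\<^sup>k\<close>.\<close>

lemma pow_mat_geometric_bound:
  fixes A :: "real mat"
  assumes A: "A \<in> carrier_mat n n" and n: "n > 0" and r: "real_spectral_radius A < r" "0 < r"
  shows "\<exists>C. \<forall>k. \<forall>i<n. \<forall>j<n. \<bar>(A ^\<^sub>m k) $$ (i, j)\<bar> \<le> C * r ^ k"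
proof -
  let ?A = "map_mat complex_of_real A"
  let ?s = "complex_of_real (1 / r)"
  have cA: "?A \<in> carrier_mat n n"
    using A by simp
  have "spectral_radius (0 \<cdot>\<^sub>m 1\<^sub>m n + ?s \<cdot>\<^sub>m ?A) \<le> norm (0::complex) + norm ?s * spectral_radius ?A"
    by (rule spectral_radius_affine_le[OF cA n])
  also have "0 \<cdot>\<^sub>m 1\<^sub>m n + ?s \<cdot>\<^sub>m ?A = ?s \<cdot>\<^sub>m ?A"
    using A by (intro eq_matI) auto
  also have "norm (0::complex) + norm ?s * spectral_radius ?A < 1"
    using r by (simp add: real_spectral_radius_def norm_divide)
  finally have "spectral_radius (?s \<cdot>\<^sub>m ?A) < 1" .
  then obtain C where C: "norm_bound ((?s \<cdot>\<^sub>m ?A) ^\<^sub>m k) C" for k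
    using spectral_radius_jnf_norm_bound_less_1_upper_triangular[of "?s \<cdot>\<^sub>m ?A" n] A by auto
  have "\<bar>(A ^\<^sub>m k) $$ (i, j)\<bar> \<le> C * r ^ k" if ij: "i < n" "j < n" for k i j
  proof -
    have Ak: "A ^\<^sub>m k \<in> carrier_mat n n"
      using A by simp
    have "(?s \<cdot>\<^sub>m ?A) ^\<^sub>m k = ?s ^ k \<cdot>\<^sub>m map_mat complex_of_real (A ^\<^sub>m k)"
      by (simp only: pow_mat_smult[OF cA] of_real_hom.mat_hom_pow[OF A])
    with C[of k] have "norm_bound (?s ^ k \<cdot>\<^sub>m map_mat complex_of_real (A ^\<^sub>m k)) C"
      by simp
    with Ak ij have "norm (?s ^ k * complex_of_real ((A ^\<^sub>m k) $$ (i, j))) \<le> C"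
      using A by (auto simp: norm_bound_def split: if_splits)
    then show ?thesis
      using r by (simp add: norm_mult norm_power norm_divide field_simps)
  qed
  then show ?thesis by blast
qed

section \<open>Maps whose coordinate distances contract under a matrix\<close>

text \<open>The estimate iterates because a matrix with nonnegative entries acts monotonically: a
  bound on the distances may be inserted into the bound for the next step. The sum runs over the
  row index of \<open>B\<close>, to match the coupling \<open>W\<^sub>i\<^sub>j\<close> from unit \<open>i\<close> into unit \<open>j\<close>.\<close>

lemma funpow_coordinate_bound:
  fixes F :: "real vec \<Rightarrow> real vec" and B :: "real mat"
  assumes F: "\<And>x. x \<in> carrier_vec n \<Longrightarrow> F x \<in> carrier_vec n"
    and B: "B \<in> carrier_mat n n" and B_nonneg: "\<And>i j. i < n \<Longrightarrow> j < n \<Longrightarrow> 0 \<le> B $$ (i, j)"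
    and F_le: "\<And>x y j. x \<in> carrier_vec n \<Longrightarrow> y \<in> carrier_vec n \<Longrightarrow> j < n \<Longrightarrow>
        \<bar>F x $ j - F y $ j\<bar> \<le> (\<Sum>i<n. B $$ (i, j) * \<bar>x $ i - y $ i\<bar>)"
    and xy: "x \<in> carrier_vec n" "y \<in> carrier_vec n" and j: "j < n"
  shows "\<bar>(F ^^ k) x $ j - (F ^^ k) y $ j\<bar> \<le> (\<Sum>i<n. (B ^\<^sub>m k) $$ (i, j) * \<bar>x $ i - y $ i\<bar>)"
  using j
proof (induction k arbitrary: j)
  case 0
  have "(\<Sum>i<n. (B ^\<^sub>m 0) $$ (i, j) * \<bar>x $ i - y $ i\<bar>)
      = (\<Sum>i<n. if i = j then \<bar>x $ i - y $ i\<bar> else 0)"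
    using B 0 by (intro sum.cong) auto
  then show ?case
    using 0 by simp
next
  case (Suc k)
  have funpow: "(F ^^ k) u \<in> carrier_vec n" if "u \<in> carrier_vec n" for u
    using that F by (induction k) auto
  have Bk: "B ^\<^sub>m k \<in> carrier_mat n n"
    using B by simp
  have "\<bar>(F ^^ Suc k) x $ j - (F ^^ Suc k) y $ j\<bar>
      \<le> (\<Sum>l<n. B $$ (l, j) * \<bar>(F ^^ k) x $ l - (F ^^ k) y $ l\<bar>)"
    using F_le[OF funpow[OF xy(1)] funpow[OF xy(2)] Suc.prems] by simp
  also have "\<dots> \<le> (\<Sum>l<n. B $$ (l, j) * (\<Sum>i<n. (B ^\<^sub>m k) $$ (i, l) * \<bar>x $ i - y $ i\<bar>))"
    using Suc B_nonneg by (intro sum_mono mult_left_mono) auto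
  also have "\<dots> = (\<Sum>i<n. (\<Sum>l<n. (B ^\<^sub>m k) $$ (i, l) * B $$ (l, j)) * \<bar>x $ i - y $ i\<bar>)"
    unfolding sum_distrib_left sum_distrib_right by (subst sum.swap) (simp add: mult_ac)
  also have "\<dots> = (\<Sum>i<n. (B ^\<^sub>m Suc k) $$ (i, j) * \<bar>x $ i - y $ i\<bar>)"
    using B Bk Suc.prems
    by (intro sum.cong) (auto simp: scalar_prod_def lessThan_atLeast0)
  finally show ?case .
qed

text \<open>The entries of the powers of the matrix \<open>B\<close> are at most \<open>C r\<^sup>k\<close> with \<open>r < 1\<close>, so the steps
  of any orbit form a summable series and two orbits approach each other like \<open>r\<^sup>k\<close>.\<close>

lemma matrix_contraction_fixed_point:
  fixes F :: "real vec \<Rightarrow> real vec" and B :: "real mat"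
  assumes n: "n > 0" and F: "\<And>x. x \<in> carrier_vec n \<Longrightarrow> F x \<in> carrier_vec n"
    and B: "B \<in> carrier_mat n n" and B_nonneg: "\<And>i j. i < n \<Longrightarrow> j < n \<Longrightarrow> 0 \<le> B $$ (i, j)"
    and F_le: "\<And>x y j. x \<in> carrier_vec n \<Longrightarrow> y \<in> carrier_vec n \<Longrightarrow> j < n \<Longrightarrow>
        \<bar>F x $ j - F y $ j\<bar> \<le> (\<Sum>i<n. B $$ (i, j) * \<bar>x $ i - y $ i\<bar>)"
    and \<rho>: "real_spectral_radius B < 1"
  shows "\<exists>z. globally_attracting_fixed_point n F z"
proof -
  \<comment> \<open>Any rate strictly between the spectral radius and \<open>1\<close> would do; the maximum with
    \<open>1 / 2\<close> makes its positivity immediate.\<close>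
  define r where "r = max (1 / 2) ((real_spectral_radius B + 1) / 2)"
  have r: "real_spectral_radius B < r" "0 < r" "r < 1"
    using \<rho> by (auto simp: r_def less_max_iff_disj field_simps)
  obtain C where C: "\<bar>(B ^\<^sub>m k) $$ (i, j)\<bar> \<le> C * r ^ k" if "i < n" "j < n" for k i j
    using pow_mat_geometric_bound[OF B n r(1,2)] by blast
  have orbits: "\<bar>(F ^^ k) x $ j - (F ^^ k) y $ j\<bar> \<le> C * r ^ k * (\<Sum>i<n. \<bar>x $ i - y $ i\<bar>)"
    if "x \<in> carrier_vec n" "y \<in> carrier_vec n" "j < n" for x y j k
  proof -
    have "\<bar>(F ^^ k) x $ j - (F ^^ k) y $ j\<bar> \<le> (\<Sum>i<n. (B ^\<^sub>m k) $$ (i, j) * \<bar>x $ i - y $ i\<bar>)"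
      using that by (intro funpow_coordinate_bound F B B_nonneg F_le)
    also have "\<dots> \<le> (\<Sum>i<n. C * r ^ k * \<bar>x $ i - y $ i\<bar>)"
      using C that by (intro sum_mono mult_right_mono) (auto simp: abs_le_iff)
    finally show ?thesis
      by (simp add: sum_distrib_left)
  qed
  have decay: "(\<lambda>k. C * r ^ k * M) \<longlonglongrightarrow> 0" for M
    using r by (auto intro!: tendsto_eq_intros LIMSEQ_power_zero)

  define u where "u k = (F ^^ k) (0\<^sub>v n)" for k
  have u: "u k \<in> carrier_vec n" for k
    by (induction k) (auto simp: u_def F)
  have u_convergent: "convergent (\<lambda>k. u k $ j)" if j: "j < n" for j
  proof -
    define M where "M = (\<Sum>i<n. \<bar>F (0\<^sub>v n) $ i - 0\<^sub>v n $ i\<bar>)"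
    have "summable (\<lambda>k. u (Suc k) $ j - u k $ j)"
    proof (rule summable_comparison_test)
      show "\<exists>N. \<forall>k\<ge>N. norm (u (Suc k) $ j - u k $ j) \<le> C * r ^ k * M"
        using orbits[of "F (0\<^sub>v n)" "0\<^sub>v n" j] j F
        by (auto simp: u_def M_def funpow_swap1)
      show "summable (\<lambda>k. C * r ^ k * M)"
        using r by (intro summable_mult summable_mult2 summable_geometric) auto
    qed
    then have "convergent (\<lambda>k. u k $ j - u 0 $ j)"
      by (simp add: summable_iff_convergent sum_lessThan_telescope[of "\<lambda>k. u k $ j"])
    from convergent_add[OF this convergent_const[of "u 0 $ j"]] show ?thesis
      by simp
  qed
  define z where "z = vec n (\<lambda>j. lim (\<lambda>k. u k $ j))"
  have z: "z \<in> carrier_vec n"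
    by (simp add: z_def)
  have u_lim: "(\<lambda>k. u k $ j) \<longlonglongrightarrow> z $ j" if "j < n" for j
    using u_convergent[OF that] that by (simp add: z_def convergent_LIMSEQ_iff)
  have Fz: "F z = z"
  proof (rule eq_vecI)
    fix j assume "j < dim_vec z"
    then have j: "j < n" using z by simp
    have bound_lim: "(\<lambda>k. \<Sum>i<n. B $$ (i, j) * \<bar>u k $ i - z $ i\<bar>) \<longlonglongrightarrow> 0"
    proof -
      have "(\<lambda>k. \<Sum>i<n. B $$ (i, j) * \<bar>u k $ i - z $ i\<bar>)
          \<longlonglongrightarrow> (\<Sum>i<n. B $$ (i, j) * \<bar>z $ i - z $ i\<bar>)"
        by (intro tendsto_intros u_lim) auto
      then show ?thesis by simp
    qed
    have "(\<lambda>k. u (Suc k) $ j - F z $ j) \<longlonglongrightarrow> 0"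
    proof (rule Lim_null_comparison[OF _ bound_lim])
      show "\<forall>\<^sub>F k in sequentially. norm (u (Suc k) $ j - F z $ j)
          \<le> (\<Sum>i<n. B $$ (i, j) * \<bar>u k $ i - z $ i\<bar>)"
        using F_le[OF u z j] by (simp add: u_def)
    qed
    then have "(\<lambda>k. u (Suc k) $ j) \<longlonglongrightarrow> F z $ j"
      by (simp add: LIM_zero_iff)
    moreover have "(\<lambda>k. u (Suc k) $ j) \<longlonglongrightarrow> z $ j"
      using u_lim[OF j] by (rule LIMSEQ_Suc)
    ultimately show "F z $ j = z $ j"
      by (rule LIMSEQ_unique)
  qed (use z F[OF z] in auto)
  have Fkz: "(F ^^ k) z = z" for k
    by (induction k) (auto simp: Fz)
  have "(\<lambda>k. MAX i\<in>{..<n}. \<bar>(F ^^ k) x $ i - z $ i\<bar>) \<longlonglongrightarrow> 0" if x: "x \<in> carrier_vec n" for x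
  proof (rule Lim_null_comparison[OF _ decay])
    have "norm (MAX i\<in>{..<n}. \<bar>(F ^^ k) x $ i - z $ i\<bar>)
        \<le> C * r ^ k * (\<Sum>i<n. \<bar>x $ i - z $ i\<bar>)" for k
    proof -
      have ne: "(\<lambda>i. \<bar>(F ^^ k) x $ i - z $ i\<bar>) ` {..<n} \<noteq> {}"
        using n by auto
      have "(MAX i\<in>{..<n}. \<bar>(F ^^ k) x $ i - z $ i\<bar>) \<in> (\<lambda>i. \<bar>(F ^^ k) x $ i - z $ i\<bar>) ` {..<n}"
        using ne by (intro Max_in) auto
      then show ?thesis
        using orbits[OF x z, of _ k] by (auto simp: Fkz)
    qed
    then show "\<forall>\<^sub>F k in sequentially. norm (MAX i\<in>{..<n}. \<bar>(F ^^ k) x $ i - z $ i\<bar>)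
        \<le> C * r ^ k * (\<Sum>i<n. \<bar>x $ i - z $ i\<bar>)"
      by simp
  qed
  with z Fz show ?thesis
    unfolding globally_attracting_fixed_point_def by blast
qed

section \<open>Cohen-Grossberg networks\<close>

lemma cohen_grossberg_coordinate_bound:
  fixes W :: "real mat"
  assumes W: "W \<in> carrier_mat n n" and lip: "\<And>i. i < n \<Longrightarrow> L-lipschitz_on UNIV (\<phi> i)"
    and j: "j < n"
  shows "\<bar>cohen_grossberg n \<epsilon> W \<phi> c x $ j - cohen_grossberg n \<epsilon> W \<phi> c y $ j\<bar>
      \<le> (\<Sum>i<n. (\<bar>1 - \<epsilon>\<bar> \<cdot>\<^sub>m 1\<^sub>m n + L \<cdot>\<^sub>m abs_mat W) $$ (i, j) * \<bar>x $ i - y $ i\<bar>)"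
proof -
  let ?d = "\<lambda>i. \<bar>x $ i - y $ i\<bar>"
  have "cohen_grossberg n \<epsilon> W \<phi> c x $ j - cohen_grossberg n \<epsilon> W \<phi> c y $ j
      = (1 - \<epsilon>) * (x $ j - y $ j) + (\<Sum>i<n. W $$ (i, j) * (\<phi> i (x $ i) - \<phi> i (y $ i)))"
    using j by (simp add: cohen_grossberg_def right_diff_distrib sum_subtractf)
  also have "\<bar>\<dots>\<bar> \<le> \<bar>1 - \<epsilon>\<bar> * ?d j + (\<Sum>i<n. \<bar>W $$ (i, j)\<bar> * \<bar>\<phi> i (x $ i) - \<phi> i (y $ i)\<bar>)"
    unfolding abs_mult[symmetric] by (intro order_trans[OF abs_triangle_ineq] add_left_mono sum_abs)
  also have "\<dots> \<le> \<bar>1 - \<epsilon>\<bar> * ?d j + (\<Sum>i<n. \<bar>W $$ (i, j)\<bar> * (L * ?d i))"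
    using lipschitz_onD[OF lip] by (intro add_left_mono sum_mono mult_left_mono) (auto simp: dist_real_def)
  also have "\<dots> = (\<Sum>i<n. (if i = j then \<bar>1 - \<epsilon>\<bar> * ?d i else 0) + L * \<bar>W $$ (i, j)\<bar> * ?d i)"
    using j by (simp add: sum.distrib mult_ac)
  also have "\<dots> = (\<Sum>i<n. (\<bar>1 - \<epsilon>\<bar> \<cdot>\<^sub>m 1\<^sub>m n + L \<cdot>\<^sub>m abs_mat W) $$ (i, j) * ?d i)"
    using W j by (intro sum.cong) (auto simp: abs_mat_def algebra_simps)
  finally show ?thesis .
qed

theorem theorem2p4:
  fixes n :: nat and \<epsilon> L :: real and c :: "real vec" and W :: "real mat"
    and \<phi> :: "nat \<Rightarrow> real \<Rightarrow> real"
  assumes "n \<ge> 1"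
    and "\<epsilon> \<noteq> 1"
    and "c \<in> carrier_vec n"
    and "W \<in> carrier_mat n n"
    and "L \<ge> 0"
    and "\<And>i. i < n \<Longrightarrow> smooth (\<phi> i)"
    and "\<And>i. i < n \<Longrightarrow> sigmoidal (\<phi> i)"
    and "\<And>i. i < n \<Longrightarrow> L-lipschitz_on UNIV (\<phi> i)"
    and "\<bar>1 - \<epsilon>\<bar> + L * real_spectral_radius (abs_mat W) < 1"
  shows "\<exists>z. globally_attracting_fixed_point n (cohen_grossberg n \<epsilon> W \<phi> c) z"
proof (rule matrix_contraction_fixed_point)
  let ?B = "\<bar>1 - \<epsilon>\<bar> \<cdot>\<^sub>m 1\<^sub>m n + L \<cdot>\<^sub>m abs_mat W"
  have absW: "abs_mat W \<in> carrier_mat n n"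
    using assms(4) by (simp add: abs_mat_def)
  show n: "n > 0"
    using assms(1) by simp
  show "cohen_grossberg n \<epsilon> W \<phi> c x \<in> carrier_vec n" for x
    by (simp add: cohen_grossberg_def)
  show "?B \<in> carrier_mat n n"
    using absW by simp
  show "0 \<le> ?B $$ (i, j)" if "i < n" "j < n" for i j
    using that assms(4,5) by (auto simp: abs_mat_def)
  show "\<bar>cohen_grossberg n \<epsilon> W \<phi> c x $ j - cohen_grossberg n \<epsilon> W \<phi> c y $ j\<bar>
      \<le> (\<Sum>i<n. ?B $$ (i, j) * \<bar>x $ i - y $ i\<bar>)" if "j < n" for x y j
    using assms(4,8) that by (rule cohen_grossberg_coordinate_bound)
  let ?cW = "map_mat complex_of_real (abs_mat W)"
  have "map_mat complex_of_real ?B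
      = complex_of_real \<bar>1 - \<epsilon>\<bar> \<cdot>\<^sub>m 1\<^sub>m n + complex_of_real L \<cdot>\<^sub>m ?cW"
    using absW by (intro eq_matI) auto
  then have "real_spectral_radius ?B \<le> \<bar>1 - \<epsilon>\<bar> + L * real_spectral_radius (abs_mat W)"
    using spectral_radius_affine_le[of ?cW n "complex_of_real \<bar>1 - \<epsilon>\<bar>" "complex_of_real L"]
      absW n assms(5) by (simp add: real_spectral_radius_def)
  with assms(9) show "real_spectral_radius ?B < 1"
    by simp
qed

end
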